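(* Let $n,m,p,T$ be positive integers with $m\ge p$, let $A_{\rm m}\in\mathbb{R}^{n\times n}$ be Schur and let $B_{\rm m}\in\mathbb{R}^{n\times p}$. Let $(U_-,X)$ be data generated by the noiseless system $x(t+1)=A_{\rm s}x(t)+B_{\rm s}u(t)$, where $A_{\rm s}\in\mathbb{R}^{n\times n}$ and $B_{\rm s}\in\mathbb{R}^{n\times m}$, with associated matrices $X_-,X_+\in\mathbb{R}^{n\times T}$ and $U_-\in\mathbb{R}^{m\times T}$. Then the data $(U_-,X)$ are informative for model reference control (MRC) if and only if there exist gains $K\in\mathbb{R}^{m\times n}$, $L\in\mathbb{R}^{m\times p}$ and scalars $\alpha_1,\alpha_2>0$ such that $$\begin{bmatrix} X_+X_+^{\top}&-X_+X_-^{\top}&-X_+U_-^{\top}&-A_{\rm m}\\ -X_-X_+^{\top}&X_-X_-^{\top}&X_-U_-^{\top}&I\\ -U_-X_+^{\top}&U_-X_-^{\top}&U_-U_-^{\top}&K\\ -A_{\rm m}^{\top}&I&K^{\top}&\alpha_1I \end{bmatrix}\geq 0$$ and $$\begin{bmatrix} X_+X_+^{\top}&-X_+X_-^{\top}&-X_+U_-^{\top}&-B_{\rm m}\\ -X_-X_+^{\top}&X_-X_-^{\top}&X_-U_-^{\top}&0\\ -U_-X_+^{\top}&U_-X_-^{\top}&U_-U_-^{\top}&L\\ -B_{\rm m}^{\top}&0&L^{\top}&\alpha_2I \end{bmatrix}\geq 0.$$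
   Context: A square real matrix is Schur if all its eigenvalues have modulus strictly less than $1$. For a real symmetric matrix, $\ge 0$ means positive semidefinite. Data: $X=[x(0)\ x(1)\ \cdots\ x(T)]\in\mathbb{R}^{n\times(T+1)}$, $U_-=[u(0)\ \cdots\ u(T-1)]\in\mathbb{R}^{m\times T}$, $X_+=[x(1)\ \cdots\ x(T)]$, $X_-=[x(0)\ \cdots\ x(T-1)]$. The data being generated by the noiseless system means $X_+=A_{\rm s}X_-+B_{\rm s}U_-$. No further assumption is made on the data. The set of systems compatible with the data is $$\Sigma_{(U_-,X)}=\{(A,B)\in\mathbb{R}^{n\times n}\times\mathbb{R}^{n\times m}\mid X_+=AX_-+BU_-\}.$$ For gains $K\in\mathbb{R}^{m\times n}$, $L\in\mathbb{R}^{m\times p}$, $$\Sigma^{K,L}_{\rm exact}=\{(A,B)\in\mathbb{R}^{n\times n}\times\mathbb{R}^{n\times m}\mid A+BK=A_{\rm m},\ BL=B_{\rm m}\}.$$ The data $(U_-,X)$ are called informative for MRC if there exist $K\in\mathbb{R}^{m\times n}$ and $L\in\mathbb{R}^{m\times p}$ such that $\Sigma_{(U_-,X)}\subseteq\Sigma^{K,L}_{\rm exact}$. *)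

theory Defs
  imports Complex_Main "Jordan_Normal_Form.Matrix" "Jordan_Normal_Form.Char_Poly"
begin

text \<open>Eigenvalues are taken over the complex numbers.\<close>

definition schur_stable :: "real mat \<Rightarrow> bool" where
  "schur_stable A \<longleftrightarrow> square_mat A \<and>
     (\<forall>z. eigenvalue (map_mat complex_of_real A) z \<longrightarrow> cmod z < 1)"

definition pos_semidef :: "real mat \<Rightarrow> bool" where
  "pos_semidef M \<longleftrightarrow> square_mat M \<and> M\<^sup>T = M \<and>
     (\<forall>v \<in> carrier_vec (dim_row M). v \<bullet> (M *\<^sub>v v) \<ge> 0)"

text \<open>Juxtaposition of matrices, dual to \<^const>\<open>append_rows\<close>.\<close>

definition append_cols :: "'a :: zero mat \<Rightarrow> 'a mat \<Rightarrow> 'a mat" (infixr "@\<^sub>c" 66) where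
  "A @\<^sub>c B = four_block_mat A B (0\<^sub>m 0 (dim_col A)) (0\<^sub>m 0 (dim_col B))"

text \<open>For \<open>X = [x(0) \<dots> x(T)]\<close>, with column \<open>t\<close> holding \<open>x(t)\<close>, these are
  \<open>[x(0) \<dots> x(T-1)]\<close> and \<open>[x(1) \<dots> x(T)]\<close>.\<close>

definition X_minus :: "real mat \<Rightarrow> real mat" where
  "X_minus X = mat (dim_row X) (dim_col X - 1) (\<lambda>(i, t). X $$ (i, t))"

definition X_plus :: "real mat \<Rightarrow> real mat" where
  "X_plus X = mat (dim_row X) (dim_col X - 1) (\<lambda>(i, t). X $$ (i, t + 1))"

text \<open>Below, \<open>n\<close>, \<open>m\<close> and \<open>p\<close> are read off from the dimensions of the arguments.\<close>

definition compatible_systems :: "real mat \<Rightarrow> real mat \<Rightarrow> (real mat \<times> real mat) set" where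
  "compatible_systems U X =
     {(A, B). A \<in> carrier_mat (dim_row X) (dim_row X) \<and> B \<in> carrier_mat (dim_row X) (dim_row U) \<and>
        X_plus X = A * X_minus X + B * U}"

definition exact_systems ::
  "real mat \<Rightarrow> real mat \<Rightarrow> real mat \<Rightarrow> real mat \<Rightarrow> (real mat \<times> real mat) set" where
  "exact_systems A\<^sub>m B\<^sub>m K L =
     {(A, B). A \<in> carrier_mat (dim_row A\<^sub>m) (dim_row A\<^sub>m) \<and> B \<in> carrier_mat (dim_row A\<^sub>m) (dim_row K) \<and>
        A + B * K = A\<^sub>m \<and> B * L = B\<^sub>m}"

definition informative_MRC :: "real mat \<Rightarrow> real mat \<Rightarrow> real mat \<Rightarrow> real mat \<Rightarrow> bool" where
  "informative_MRC A\<^sub>m B\<^sub>m U X \<longleftrightarrow>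
     (\<exists>K \<in> carrier_mat (dim_row U) (dim_row X). \<exists>L \<in> carrier_mat (dim_row U) (dim_col B\<^sub>m).
        compatible_systems U X \<subseteq> exact_systems A\<^sub>m B\<^sub>m K L)"

end

(* The first n + n + m rows of the two block matrices are [W W^T, N], where W stacks -X_+, X_-, U_-
   and N stacks -A_m, I, K, respectively -B_m, 0, L. Such a matrix is positive semidefinite for some alpha > 0 iff ker W^T is contained in ker N^T: testing
   the form on (z, -N^T z / alpha) with W^T z = 0 gives one direction; conversely, kernel inclusion
   yields a factorization N^T = H W^T, and completing the square works for alpha >= ||H||^2.
   On the system side, (A, B) is compatible with the data iff all rows of [I A B] lie in ker W^T, and
   exact iff they lie in both kernels ker N^T. As A_s, B_s is compatible, adding to it any left null
   vector of [X_-; U_-] as a row perturbation remains compatible, so informativity means precisely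
   the two kernel inclusions. *)
theory Submission
  imports Defs
begin

section \<open>Linear functionals and factorization through a kernel\<close>

lemma functional_in_span:
  fixes f :: "nat \<Rightarrow> 'a :: field vec"
  assumes "\<And>i. i < k \<Longrightarrow> f i \<in> carrier_vec r" and "g \<in> carrier_vec r"
    and "\<And>z. z \<in> carrier_vec r \<Longrightarrow> (\<And>i. i < k \<Longrightarrow> f i \<bullet> z = 0) \<Longrightarrow> g \<bullet> z = 0"
  shows "\<exists>c. \<forall>z \<in> carrier_vec r. g \<bullet> z = (\<Sum>i<k. c i * (f i \<bullet> z))"
  using assms
proof (induction k arbitrary: g)
  case 0
  then show ?case by auto
next
  case (Suc k)
  have f: "\<And>i. i \<le> k \<Longrightarrow> f i \<in> carrier_vec r" using Suc.prems(1) by auto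
  have g: "g \<in> carrier_vec r" by fact
  show ?case
  proof (cases "\<exists>z0 \<in> carrier_vec r. (\<forall>i<k. f i \<bullet> z0 = 0) \<and> f k \<bullet> z0 \<noteq> 0")
    \<comment> \<open>Here \<open>f k\<close> vanishes wherever the earlier functionals do, so
      \<open>g\<close> does too; \<open>f k\<close> then enters with coefficient 0.\<close>
    case False
    have "\<exists>c. \<forall>z \<in> carrier_vec r. g \<bullet> z = (\<Sum>i<k. c i * (f i \<bullet> z))"
    proof (rule Suc.IH)
      fix z assume z: "z \<in> carrier_vec r" "\<And>i. i < k \<Longrightarrow> f i \<bullet> z = 0"
      then have "f k \<bullet> z = 0" using False by auto
      then show "g \<bullet> z = 0" using z Suc.prems(3) by (metis less_antisym)
    qed (use f g in auto)
    then obtain c where c: "\<forall>z \<in> carrier_vec r. g \<bullet> z = (\<Sum>i<k. c i * (f i \<bullet> z))" ..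
    have "\<forall>z \<in> carrier_vec r. g \<bullet> z = (\<Sum>i<Suc k. (c(k := 0)) i * (f i \<bullet> z))"
      using c by simp
    then show ?thesis by blast
  next
    case True
    then obtain z0 where z0: "z0 \<in> carrier_vec r" "\<And>i. i < k \<Longrightarrow> f i \<bullet> z0 = 0" "f k \<bullet> z0 \<noteq> 0"
      by auto
    \<comment> \<open>The only candidate for the coefficient of \<open>f k\<close>: it makes
      \<open>g - d \<cdot>\<^sub>v f k\<close> vanish at \<open>z0\<close>.\<close>
    define d where "d = (g \<bullet> z0) / (f k \<bullet> z0)"
    have dist: "(g - d \<cdot>\<^sub>v f k) \<bullet> z = g \<bullet> z - d * (f k \<bullet> z)" if "z \<in> carrier_vec r" for z
      using that f[of k] g by (simp add: minus_scalar_prod_distrib[of _ r])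
    have "\<exists>c. \<forall>z \<in> carrier_vec r. (g - d \<cdot>\<^sub>v f k) \<bullet> z = (\<Sum>i<k. c i * (f i \<bullet> z))"
    proof (rule Suc.IH)
      fix z assume z: "z \<in> carrier_vec r" "\<And>i. i < k \<Longrightarrow> f i \<bullet> z = 0"
      \<comment> \<open>Shifting \<open>z\<close> along \<open>z0\<close> by this amount kills
        \<open>f k\<close> as well, while the earlier functionals vanish at both vectors. So
        \<open>g\<close> vanishes at the shifted vector, which says that \<open>g\<close> and
        \<open>d \<cdot>\<^sub>v f k\<close> agree at \<open>z\<close>.\<close>
      define s where "s = (f k \<bullet> z) / (f k \<bullet> z0)"
      let ?z = "z - s \<cdot>\<^sub>v z0"
      have *: "h \<bullet> ?z = h \<bullet> z - s * (h \<bullet> z0)" if "h \<in> carrier_vec r" for h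
        using that z z0 by (simp add: scalar_prod_minus_distrib[of _ r])
      have "g \<bullet> ?z = 0"
      proof (rule Suc.prems(3))
        fix i assume "i < Suc k"
        then have "f i \<bullet> ?z = f i \<bullet> z - s * (f i \<bullet> z0)" using f by (intro *) simp
        then show "f i \<bullet> ?z = 0"
          using z z0 \<open>i < Suc k\<close> by (cases "i = k") (auto simp: s_def)
      qed (use z z0 in auto)
      then show "(g - d \<cdot>\<^sub>v f k) \<bullet> z = 0"
        using dist[OF z(1)] *[OF g] by (simp add: s_def d_def)
    qed (use f g in auto)
    then obtain c where c: "\<forall>z \<in> carrier_vec r. (g - d \<cdot>\<^sub>v f k) \<bullet> z = (\<Sum>i<k. c i * (f i \<bullet> z))" ..
    have "\<forall>z \<in> carrier_vec r. g \<bullet> z = (\<Sum>i<Suc k. (c(k := d)) i * (f i \<bullet> z))"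
      using c dist by (auto simp: algebra_simps)
    then show ?thesis by blast
  qed
qed

text \<open>Each row of \<open>D\<close> vanishes on the common kernel of the rows of
  \<open>C\<close>, hence is a combination of them; the coefficients form the corresponding row of
  \<open>H\<close>.\<close>

lemma mat_factors_through_kernel:
  fixes C D :: "'a :: field mat"
  assumes C: "C \<in> carrier_mat k r" and D: "D \<in> carrier_mat q r"
    and ker: "\<And>z. z \<in> carrier_vec r \<Longrightarrow> C *\<^sub>v z = 0\<^sub>v k \<Longrightarrow> D *\<^sub>v z = 0\<^sub>v q"
  shows "\<exists>H \<in> carrier_mat q k. \<forall>z \<in> carrier_vec r. D *\<^sub>v z = H *\<^sub>v (C *\<^sub>v z)"
proof -
  have "\<exists>c. \<forall>z \<in> carrier_vec r. row D j \<bullet> z = (\<Sum>i<k. c i * (row C i \<bullet> z))" if j: "j < q" for j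
  proof (rule functional_in_span)
    fix z assume z: "z \<in> carrier_vec r" "\<And>i. i < k \<Longrightarrow> row C i \<bullet> z = 0"
    then have "C *\<^sub>v z = 0\<^sub>v k" using C by (intro eq_vecI) auto
    then have "(D *\<^sub>v z) $ j = 0" using ker z j by simp
    then show "row D j \<bullet> z = 0" using D j by simp
  qed (use C D in auto)
  then obtain c where c: "\<And>j z. j < q \<Longrightarrow> z \<in> carrier_vec r \<Longrightarrow>
      row D j \<bullet> z = (\<Sum>i<k. c j i * (row C i \<bullet> z))"
    by metis
  show ?thesis
  proof (intro bexI ballI)
    show "mat q k (\<lambda>(j, i). c j i) \<in> carrier_mat q k" by simp
    show "D *\<^sub>v z = mat q k (\<lambda>(j, i). c j i) *\<^sub>v (C *\<^sub>v z)" if "z \<in> carrier_vec r" for z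
      using C D that c
      by (intro eq_vecI) (auto simp: scalar_prod_def[of _ "C *\<^sub>v z"] atLeast0LessThan)
  qed
qed

section \<open>Inner products and norm bounds for real vectors\<close>

lemma real_scalar_prod_self_nonneg: "(v :: real vec) \<bullet> v \<ge> 0"
  by (simp add: scalar_prod_def sum_nonneg)

lemma scalar_prod_self_eq_0_iff:
  "(v :: real vec) \<in> carrier_vec n \<Longrightarrow> v \<bullet> v = 0 \<longleftrightarrow> v = 0\<^sub>v n"
  using conjugate_square_eq_0_vec[of v n] by simp

text \<open>By Lagrange's identity: the squares of all 2 by 2 minors of the pair, summed over
  ordered index pairs, give twice the gap between the two sides.\<close>

lemma Cauchy_Schwarz_vec:
  fixes a b :: "real vec"
  assumes "a \<in> carrier_vec n" and "b \<in> carrier_vec n"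
  shows "(a \<bullet> b)\<^sup>2 \<le> (a \<bullet> a) * (b \<bullet> b)"
proof -
  have "0 \<le> (\<Sum>i=0..<n. \<Sum>j=0..<n. (a $ i * b $ j - a $ j * b $ i)\<^sup>2)"
    by (intro sum_nonneg) simp
  also have "\<dots> = (\<Sum>i=0..<n. \<Sum>j=0..<n. a $ i * a $ i * (b $ j * b $ j))
      + (\<Sum>i=0..<n. \<Sum>j=0..<n. b $ i * b $ i * (a $ j * a $ j))
      - 2 * (\<Sum>i=0..<n. \<Sum>j=0..<n. a $ i * b $ i * (a $ j * b $ j))"
    unfolding sum.distrib[symmetric] sum_distrib_left sum_subtractf[symmetric]
    by (intro sum.cong refl) (simp add: power2_eq_square algebra_simps)
  also have "\<dots> = 2 * ((a \<bullet> a) * (b \<bullet> b)) - 2 * (a \<bullet> b)\<^sup>2"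
  proof -
    have "(a \<bullet> a) * (b \<bullet> b) = (\<Sum>i=0..<n. \<Sum>j=0..<n. a $ i * a $ i * (b $ j * b $ j))"
      and "(b \<bullet> b) * (a \<bullet> a) = (\<Sum>i=0..<n. \<Sum>j=0..<n. b $ i * b $ i * (a $ j * a $ j))"
      and "(a \<bullet> b) * (a \<bullet> b) = (\<Sum>i=0..<n. \<Sum>j=0..<n. a $ i * b $ i * (a $ j * b $ j))"
      using assms by (simp_all add: scalar_prod_def sum_product)
    then show ?thesis by (simp add: power2_eq_square mult.commute)
  qed
  finally show ?thesis by simp
qed

lemma mult_mat_vec_bounded:
  fixes M :: "real mat"
  assumes M: "M \<in> carrier_mat k q"
  shows "\<exists>\<alpha> > 0. \<forall>y \<in> carrier_vec q. (M *\<^sub>v y) \<bullet> (M *\<^sub>v y) \<le> \<alpha> * (y \<bullet> y)"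
proof -
  \<comment> \<open>The squared Frobenius norm bounds the squared operator norm; the added 1 keeps
    the constant positive even for \<open>M = 0\<close>.\<close>
  define \<alpha> where "\<alpha> = 1 + (\<Sum>i<k. row M i \<bullet> row M i)"
  have "(M *\<^sub>v y) \<bullet> (M *\<^sub>v y) \<le> \<alpha> * (y \<bullet> y)" if y: "y \<in> carrier_vec q" for y
  proof -
    have "(M *\<^sub>v y) \<bullet> (M *\<^sub>v y) = (\<Sum>i<k. (row M i \<bullet> y)\<^sup>2)"
      using M by (auto simp: scalar_prod_def[of _ "M *\<^sub>v y"] atLeast0LessThan power2_eq_square)
    also have "\<dots> \<le> (\<Sum>i<k. (row M i \<bullet> row M i) * (y \<bullet> y))"
      using M y by (intro sum_mono Cauchy_Schwarz_vec) auto
    also have "\<dots> \<le> \<alpha> * (y \<bullet> y)"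
      using real_scalar_prod_self_nonneg[of y] by (simp add: \<alpha>_def sum_distrib_right ring_distribs)
    finally show ?thesis .
  qed
  moreover have "\<alpha> > 0"
    unfolding \<alpha>_def by (intro add_pos_nonneg sum_nonneg real_scalar_prod_self_nonneg) simp
  ultimately show ?thesis by blast
qed

section \<open>Semidefiniteness of a bordered Gram matrix\<close>

text \<open>Moving \<open>W\<close> and \<open>N\<close> across the inner product as transposes
  leaves a form that sees z only through W^T z and N^T z; the two off-diagonal blocks contribute
  equally, hence the factor 2.\<close>

lemma four_block_quadratic_form:
  fixes W N :: "real mat"
  assumes W: "W \<in> carrier_mat r k" and N: "N \<in> carrier_mat r q"
    and z: "z \<in> carrier_vec r" and y: "y \<in> carrier_vec q"
  shows "(z @\<^sub>v y) \<bullet> (four_block_mat (W * W\<^sup>T) N N\<^sup>T (\<alpha> \<cdot>\<^sub>m 1\<^sub>m q) *\<^sub>v (z @\<^sub>v y))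
    = (W\<^sup>T *\<^sub>v z) \<bullet> (W\<^sup>T *\<^sub>v z) + 2 * ((N\<^sup>T *\<^sub>v z) \<bullet> y) + \<alpha> * (y \<bullet> y)"
proof -
  have 1: "z \<bullet> (W *\<^sub>v (W\<^sup>T *\<^sub>v z)) = (W\<^sup>T *\<^sub>v z) \<bullet> (W\<^sup>T *\<^sub>v z)"
    using W z by (intro transpose_vec_mult_scalar[symmetric]) auto
  have 2: "z \<bullet> (N *\<^sub>v y) = (N\<^sup>T *\<^sub>v z) \<bullet> y"
    using N z y by (intro transpose_vec_mult_scalar[symmetric]) auto
  have 3: "y \<bullet> (N\<^sup>T *\<^sub>v z) = (N\<^sup>T *\<^sub>v z) \<bullet> y"
    using N z y by (intro comm_scalar_prod) auto
  have 4: "(\<alpha> \<cdot>\<^sub>m 1\<^sub>m q) *\<^sub>v y = \<alpha> \<cdot>\<^sub>v y"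
    using y by auto
  have c: "W * W\<^sup>T \<in> carrier_mat r r" "W *\<^sub>v (W\<^sup>T *\<^sub>v z) \<in> carrier_vec r"
    "N *\<^sub>v y \<in> carrier_vec r" "N\<^sup>T *\<^sub>v z \<in> carrier_vec q" "N\<^sup>T \<in> carrier_mat q r"
    "\<alpha> \<cdot>\<^sub>m 1\<^sub>m q \<in> carrier_mat q q"
    using W N z y by auto
  have "(W * W\<^sup>T) *\<^sub>v z = W *\<^sub>v (W\<^sup>T *\<^sub>v z)"
    using W z by (intro assoc_mult_mat_vec) auto
  then have "four_block_mat (W * W\<^sup>T) N N\<^sup>T (\<alpha> \<cdot>\<^sub>m 1\<^sub>m q) *\<^sub>v (z @\<^sub>v y)
      = (W *\<^sub>v (W\<^sup>T *\<^sub>v z) + N *\<^sub>v y) @\<^sub>v (N\<^sup>T *\<^sub>v z + \<alpha> \<cdot>\<^sub>v y)"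
    using four_block_mat_mult_vec[OF c(1) N c(5,6) z y] 4 by simp
  then show ?thesis
    using c(2-4) z y
    by (simp add: scalar_prod_append[of _ r _ q] scalar_prod_add_distrib[of _ r]
        scalar_prod_add_distrib[of _ q] 1 2 3)
qed

lemma pos_semidef_four_block_iff:
  fixes W N :: "real mat"
  assumes W: "W \<in> carrier_mat r k" and N: "N \<in> carrier_mat r q"
  shows "(\<exists>\<alpha> > 0. pos_semidef (four_block_mat (W * W\<^sup>T) N N\<^sup>T (\<alpha> \<cdot>\<^sub>m 1\<^sub>m q))) \<longleftrightarrow>
    (\<forall>z \<in> carrier_vec r. W\<^sup>T *\<^sub>v z = 0\<^sub>v k \<longrightarrow> N\<^sup>T *\<^sub>v z = 0\<^sub>v q)"
    (is "(\<exists>\<alpha> > 0. pos_semidef (?M \<alpha>)) \<longleftrightarrow> ?R")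
proof -
  have M: "?M \<alpha> \<in> carrier_mat (r + q) (r + q)" for \<alpha> using W N by auto
  have diag: "(\<alpha> \<cdot>\<^sub>m 1\<^sub>m q)\<^sup>T = \<alpha> \<cdot>\<^sub>m (1\<^sub>m q :: real mat)" for \<alpha>
    by (intro eq_matI) auto
  have sym: "(?M \<alpha>)\<^sup>T = ?M \<alpha>" for \<alpha>
    using W N diag by (subst transpose_four_block_mat[of _ r r _ q _ q])
      (auto simp: transpose_mult[of _ r k])
  have psd: "pos_semidef (?M \<alpha>) \<longleftrightarrow> (\<forall>z \<in> carrier_vec r. \<forall>y \<in> carrier_vec q.
      0 \<le> (W\<^sup>T *\<^sub>v z) \<bullet> (W\<^sup>T *\<^sub>v z) + 2 * ((N\<^sup>T *\<^sub>v z) \<bullet> y) + \<alpha> * (y \<bullet> y))" for \<alpha>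
  proof -
    have "dim_row (?M \<alpha>) = r + q" "square_mat (?M \<alpha>)" using M[of \<alpha>] by auto
    then have "pos_semidef (?M \<alpha>) \<longleftrightarrow> (\<forall>v \<in> carrier_vec (r + q). v \<bullet> (?M \<alpha> *\<^sub>v v) \<ge> 0)"
      unfolding pos_semidef_def using sym by simp
    then show ?thesis
      unfolding all_vec_append by (simp add: four_block_quadratic_form[OF W N] cong: ball_cong)
  qed
  show ?thesis
  proof
    assume "\<exists>\<alpha> > 0. pos_semidef (?M \<alpha>)"
    then obtain \<alpha> where \<alpha>: "\<alpha> > 0" and nonneg: "\<And>z y. z \<in> carrier_vec r \<Longrightarrow> y \<in> carrier_vec q \<Longrightarrow>
        0 \<le> (W\<^sup>T *\<^sub>v z) \<bullet> (W\<^sup>T *\<^sub>v z) + 2 * ((N\<^sup>T *\<^sub>v z) \<bullet> y) + \<alpha> * (y \<bullet> y)"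
      using psd by auto
    show ?R
    proof (intro ballI impI)
      fix z assume z: "z \<in> carrier_vec r" and Wz: "W\<^sup>T *\<^sub>v z = 0\<^sub>v k"
      let ?g = "N\<^sup>T *\<^sub>v z"
      have g: "?g \<in> carrier_vec q" using N z by auto
      \<comment> \<open>For y = -g/\<alpha> the cross term is -2|g|^2/\<alpha> and the last term
        |g|^2/\<alpha>, while the first vanishes with W^T z; the total -|g|^2/\<alpha> is
        nonnegative only for g = 0.\<close>
      have "0 \<le> 2 * (- (?g \<bullet> ?g) / \<alpha>) + (?g \<bullet> ?g) / \<alpha>"
        using nonneg[OF z, of "(- 1 / \<alpha>) \<cdot>\<^sub>v ?g"] g \<alpha> by (simp add: Wz)
      then have "?g \<bullet> ?g \<le> 0" using \<alpha> by (simp add: field_simps)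
      then have "?g \<bullet> ?g = 0" using real_scalar_prod_self_nonneg[of ?g] by linarith
      then show "?g = 0\<^sub>v q" using scalar_prod_self_eq_0_iff[OF g] by simp
    qed
  next
    assume ?R
    then obtain H where H: "H \<in> carrier_mat q k"
      and NH: "\<And>z. z \<in> carrier_vec r \<Longrightarrow> N\<^sup>T *\<^sub>v z = H *\<^sub>v (W\<^sup>T *\<^sub>v z)"
      using mat_factors_through_kernel[of "W\<^sup>T" k r "N\<^sup>T" q] W N by auto
    obtain \<alpha> where \<alpha>: "\<alpha> > 0"
      and bound: "\<And>y. y \<in> carrier_vec q \<Longrightarrow> (H\<^sup>T *\<^sub>v y) \<bullet> (H\<^sup>T *\<^sub>v y) \<le> \<alpha> * (y \<bullet> y)"
      using mult_mat_vec_bounded[of "H\<^sup>T" k q] H by auto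
    have "0 \<le> (W\<^sup>T *\<^sub>v z) \<bullet> (W\<^sup>T *\<^sub>v z) + 2 * ((N\<^sup>T *\<^sub>v z) \<bullet> y) + \<alpha> * (y \<bullet> y)"
      if z: "z \<in> carrier_vec r" and y: "y \<in> carrier_vec q" for z y
    proof -
      \<comment> \<open>Since N^T z = H s, the cross term is 2 (s . h), and \<alpha>|y|^2 is at
        least |h|^2. The form is therefore at least |s + h|^2.\<close>
      let ?s = "W\<^sup>T *\<^sub>v z" and ?h = "H\<^sup>T *\<^sub>v y"
      have s: "?s \<in> carrier_vec k" and h: "?h \<in> carrier_vec k" using W z H y by auto
      have "(N\<^sup>T *\<^sub>v z) \<bullet> y = ?s \<bullet> ?h"
        using transpose_vec_mult_scalar[of "H\<^sup>T" k q y ?s] H s y NH[OF z] by simp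
      moreover have "(?s + ?h) \<bullet> (?s + ?h) = ?s \<bullet> ?s + 2 * (?s \<bullet> ?h) + ?h \<bullet> ?h"
        using s h comm_scalar_prod[OF h s]
        by (simp add: scalar_prod_add_distrib[of _ k] add_scalar_prod_distrib[of _ k])
      ultimately show ?thesis
        using real_scalar_prod_self_nonneg[of "?s + ?h"] bound[OF y] by linarith
    qed
    then show "\<exists>\<alpha> > 0. pos_semidef (?M \<alpha>)" using \<alpha> psd by blast
  qed
qed

section \<open>The displayed block matrices as bordered Gram matrices\<close>

lemma dim_append_cols [simp]:
  "dim_row (A @\<^sub>c B) = dim_row A" "dim_col (A @\<^sub>c B) = dim_col A + dim_col B"
  by (simp_all add: append_cols_def)

lemma dim_append_rows [simp]:
  "dim_row (A @\<^sub>r B) = dim_row A + dim_row B" "dim_col (A @\<^sub>r B) = dim_col A"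
  by (simp_all add: append_rows_def)

lemma index_append_cols:
  "i < dim_row A \<Longrightarrow> j < dim_col A + dim_col B \<Longrightarrow>
    (A @\<^sub>c B) $$ (i, j) = (if j < dim_col A then A $$ (i, j) else B $$ (i, j - dim_col A))"
  by (simp add: append_cols_def)

lemma index_append_rows:
  "i < dim_row A + dim_row B \<Longrightarrow> j < dim_col A \<Longrightarrow>
    (A @\<^sub>r B) $$ (i, j) = (if i < dim_row A then A $$ (i, j) else B $$ (i - dim_row A, j))"
  by (simp add: append_rows_def)

lemma row_append_rows:
  assumes "A \<in> carrier_mat r c" and "B \<in> carrier_mat s c" and "i < r + s"
  shows "row (A @\<^sub>r B) i = (if i < r then row A i else row B (i - r))"
  using assms by (intro eq_vecI) (auto simp: index_append_rows)

text \<open>The sign on \<open>P\<close> in the stack cancels in the corner block and survives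
  exactly in its products with \<open>Q\<close> and \<open>R\<close>. Keeping \<open>B\<close> and
  \<open>D\<close> general lets one identity serve both matrix inequalities.\<close>

lemma block_matrix_eq:
  fixes P Q R :: "real mat"
  assumes P: "P \<in> carrier_mat n k" and Q: "Q \<in> carrier_mat n' k" and R: "R \<in> carrier_mat m k"
    and A: "A \<in> carrier_mat n q" and B: "B \<in> carrier_mat n' q" and C: "C \<in> carrier_mat m q"
    and D: "D \<in> carrier_mat q q"
  shows "(P * P\<^sup>T @\<^sub>c - (P * Q\<^sup>T) @\<^sub>c - (P * R\<^sup>T) @\<^sub>c - A) @\<^sub>r
      (- (Q * P\<^sup>T) @\<^sub>c Q * Q\<^sup>T @\<^sub>c Q * R\<^sup>T @\<^sub>c B) @\<^sub>r
      (- (R * P\<^sup>T) @\<^sub>c R * Q\<^sup>T @\<^sub>c R * R\<^sup>T @\<^sub>c C) @\<^sub>r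
      (- A\<^sup>T @\<^sub>c B\<^sup>T @\<^sub>c C\<^sup>T @\<^sub>c D)
    = four_block_mat ((- P @\<^sub>r Q @\<^sub>r R) * (- P @\<^sub>r Q @\<^sub>r R)\<^sup>T) (- A @\<^sub>r B @\<^sub>r C) (- A @\<^sub>r B @\<^sub>r C)\<^sup>T D"
    (is "?L = ?M")
proof (rule eq_matI)
  let ?W = "- P @\<^sub>r Q @\<^sub>r R"
  have row: "row ?W i = - row P i" if "i < n" for i
    using that P Q R by (simp add: row_append_rows[of _ n k _ "n' + m"])
  have row': "row ?W (n + i) = row Q i" if "i < n'" for i
    using that P Q R by (simp add: row_append_rows[of _ n k _ "n' + m"] row_append_rows[of _ n' k _ m])
  have row'': "row ?W (n + (n' + i)) = row R i" if "i < m" for i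
    using that P Q R by (simp add: row_append_rows[of _ n k _ "n' + m"] row_append_rows[of _ n' k _ m])
  \<comment> \<open>An index lies in one of four consecutive blocks; writing it as block start plus
    offset lets simplification resolve all sixteen pairs of blocks.\<close>
  have split: thesis if "i < n + (n' + (m + q))" "i < n \<Longrightarrow> thesis"
    "\<And>i'. i = n + i' \<Longrightarrow> i' < n' \<Longrightarrow> thesis"
    "\<And>i'. i = n + (n' + i') \<Longrightarrow> i' < m \<Longrightarrow> thesis"
    "\<And>i'. i = n + (n' + (m + i')) \<Longrightarrow> i' < q \<Longrightarrow> thesis" for i thesis
    using that(2) that(3)[of "i - n"] that(4)[of "i - n - n'"] that(5)[of "i - n - n' - m"] that(1)
    by linarith
  have dims: "dim_row P = n" "dim_col P = k" "dim_row Q = n'" "dim_col Q = k"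
    "dim_row R = m" "dim_col R = k" "dim_row A = n" "dim_col A = q" "dim_row B = n'"
    "dim_col B = q" "dim_row C = m" "dim_col C = q" "dim_row D = q" "dim_col D = q"
    using P Q R A B C D by auto
  show "?L $$ (i, j) = ?M $$ (i, j)" if "i < dim_row ?M" "j < dim_col ?M" for i j
  proof -
    have "i < n + (n' + (m + q))" "j < n + (n' + (m + q))" using that dims by auto
    then show ?thesis
      by (elim split[of i] split[of j])
        (simp_all add: index_append_cols index_append_rows row row' row'' dims add.assoc)
  qed
qed (use P Q R A B C D in auto)

section \<open>Transposed stacks acting on stacked vectors\<close>

lemma transpose_append_rows_mult_vec:
  fixes A B :: "'a :: comm_ring_1 mat"
  assumes A: "A \<in> carrier_mat r k" and B: "B \<in> carrier_mat s k"
    and x: "x \<in> carrier_vec r" and y: "y \<in> carrier_vec s"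
  shows "(A @\<^sub>r B)\<^sup>T *\<^sub>v (x @\<^sub>v y) = A\<^sup>T *\<^sub>v x + B\<^sup>T *\<^sub>v y"
proof (rule eq_vecI)
  fix i assume "i < dim_vec (A\<^sup>T *\<^sub>v x + B\<^sup>T *\<^sub>v y)"
  then have i: "i < k" using B by simp
  have "col (A @\<^sub>r B) i = col A i @\<^sub>v col B i"
    using A B i by (intro eq_vecI) (auto simp: index_append_rows)
  then show "((A @\<^sub>r B)\<^sup>T *\<^sub>v (x @\<^sub>v y)) $ i = (A\<^sup>T *\<^sub>v x + B\<^sup>T *\<^sub>v y) $ i"
    using A B x y i by (simp add: scalar_prod_append[of _ r _ s])
qed (use A B in auto)

lemma transpose_stack3_mult_vec:
  fixes P Q R :: "'a :: comm_ring_1 mat"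
  assumes "P \<in> carrier_mat n k" and "Q \<in> carrier_mat n' k" and "R \<in> carrier_mat m k"
    and "c \<in> carrier_vec n" and "a \<in> carrier_vec n'" and "b \<in> carrier_vec m"
  shows "(- P @\<^sub>r Q @\<^sub>r R)\<^sup>T *\<^sub>v (c @\<^sub>v a @\<^sub>v b) = - (P\<^sup>T *\<^sub>v c) + (Q\<^sup>T *\<^sub>v a + R\<^sup>T *\<^sub>v b)"
  using assms
  by (simp add: transpose_append_rows_mult_vec[of _ n k _ "n' + m"]
      transpose_append_rows_mult_vec[of _ n' k _ m] transpose_uminus)

section \<open>Perturbations with equal rows\<close>

text \<open>Turns a left null vector into a matrix perturbation. Filling all rows with it singles
  out no row, and sums and right multiples of such matrices keep the same shape.\<close>

definition repeat_row :: "nat \<Rightarrow> 'a vec \<Rightarrow> 'a mat" where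
  "repeat_row n w = mat n (dim_vec w) (\<lambda>(i, j). w $ j)"

lemma repeat_row_carrier [simp]: "w \<in> carrier_vec k \<Longrightarrow> repeat_row n w \<in> carrier_mat n k"
  by (auto simp: repeat_row_def)

lemma row_repeat_row [simp]: "i < n \<Longrightarrow> row (repeat_row n w) i = w"
  by (intro eq_vecI) (auto simp: repeat_row_def)

lemma dim_repeat_row [simp]:
  "dim_row (repeat_row n w) = n" "dim_col (repeat_row n w) = dim_vec w"
  by (simp_all add: repeat_row_def)

lemma index_repeat_row [simp]:
  "i < n \<Longrightarrow> j < dim_vec w \<Longrightarrow> repeat_row n w $$ (i, j) = w $ j"
  by (simp add: repeat_row_def)

lemma repeat_row_mult:
  fixes M :: "'a :: comm_ring_1 mat"
  assumes "M \<in> carrier_mat k l" and "w \<in> carrier_vec k"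
  shows "repeat_row n w * M = repeat_row n (M\<^sup>T *\<^sub>v w)"
  using assms by (intro eq_matI) (auto intro: comm_scalar_prod)

lemma repeat_row_add:
  "dim_vec v = dim_vec w \<Longrightarrow> repeat_row n v + repeat_row n w = repeat_row n (v + w)"
  by (intro eq_matI) auto

text \<open>Row 0 recovers \<open>w\<close>; this is where positivity of the state dimension
  enters.\<close>

lemma repeat_row_eq_0_iff:
  assumes "n > 0" and "w \<in> carrier_vec k"
  shows "repeat_row n w = 0\<^sub>m n k \<longleftrightarrow> w = 0\<^sub>v k"
proof
  assume "repeat_row n w = 0\<^sub>m n k"
  then have "row (repeat_row n w) 0 = 0\<^sub>v k" using \<open>n > 0\<close> by simp
  then show "w = 0\<^sub>v k" using \<open>n > 0\<close> by simp
qed (use assms in \<open>auto intro!: eq_matI\<close>)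

section \<open>Compatible and exact systems in terms of kernels\<close>

lemma transpose_mult_row:
  fixes A G :: "'a :: comm_ring_1 mat"
  assumes "A \<in> carrier_mat n k" and "G \<in> carrier_mat k l" and "i < n"
  shows "G\<^sup>T *\<^sub>v row A i = row (A * G) i"
  using assms by (intro eq_vecI) (auto intro: comm_scalar_prod[of _ k])

text \<open>The stacked vector is row i of [I A B], and the transposed stack sends it to row i of -F
  + A G + B H. Compatibility and both exactness equations are instances.\<close>

lemma stack3_kernel_rows:
  fixes F G H A B :: "'a :: comm_ring_1 mat"
  assumes F: "F \<in> carrier_mat n k" and G: "G \<in> carrier_mat n' k" and H: "H \<in> carrier_mat m k"
    and A: "A \<in> carrier_mat n n'" and B: "B \<in> carrier_mat n m"
  shows "F = A * G + B * H \<longleftrightarrow>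
    (\<forall>i<n. (- F @\<^sub>r G @\<^sub>r H)\<^sup>T *\<^sub>v (unit_vec n i @\<^sub>v row A i @\<^sub>v row B i) = 0\<^sub>v k)"
proof -
  have F_row: "F\<^sup>T *\<^sub>v unit_vec n i = row F i" if "i < n" for i
    using that F by (intro eq_vecI) auto
  have eq: "(- F @\<^sub>r G @\<^sub>r H)\<^sup>T *\<^sub>v (unit_vec n i @\<^sub>v row A i @\<^sub>v row B i)
      = - row F i + row (A * G + B * H) i" if "i < n" for i
  proof -
    have "(- F @\<^sub>r G @\<^sub>r H)\<^sup>T *\<^sub>v (unit_vec n i @\<^sub>v row A i @\<^sub>v row B i)
        = - (F\<^sup>T *\<^sub>v unit_vec n i) + (G\<^sup>T *\<^sub>v row A i + H\<^sup>T *\<^sub>v row B i)"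
      using that A B by (intro transpose_stack3_mult_vec[OF F G H]) auto
    also have "\<dots> = - row F i + (row (A * G) i + row (B * H) i)"
      using that A B G H by (simp only: F_row transpose_mult_row)
    also have "row (A * G) i + row (B * H) i = row (A * G + B * H) i"
      using that A B G H by (intro eq_vecI) auto
    finally show ?thesis .
  qed
  have row: "- row F i + row (A * G + B * H) i = 0\<^sub>v k \<longleftrightarrow> row F i = row (A * G + B * H) i" if "i < n" for i
    using that F A B G H by (auto simp: vec_eq_iff)
  have "F = A * G + B * H \<longleftrightarrow> (\<forall>i<n. row F i = row (A * G + B * H) i)"
    using F A B G H by (auto intro: eq_rowI)
  then show ?thesis using eq row by simp
qed

text \<open>As F^T c = G^T A^T c + H^T B^T c, the component \<open>c\<close> can be eliminated: z
  differs from (0, a - A^T c, b - B^T c) by a combination of the rows of [I A B], which the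
  transposed stack annihilates.\<close>

lemma stack3_reduce:
  fixes F G H A B :: "'a :: comm_ring_1 mat"
  assumes G: "G \<in> carrier_mat n' k" and H: "H \<in> carrier_mat m k"
    and A: "A \<in> carrier_mat n n'" and B: "B \<in> carrier_mat n m"
    and F: "F = A * G + B * H"
    and c: "c \<in> carrier_vec n" and a: "a \<in> carrier_vec n'" and b: "b \<in> carrier_vec m"
  shows "(- F @\<^sub>r G @\<^sub>r H)\<^sup>T *\<^sub>v (c @\<^sub>v a @\<^sub>v b)
    = G\<^sup>T *\<^sub>v (a - A\<^sup>T *\<^sub>v c) + H\<^sup>T *\<^sub>v (b - B\<^sup>T *\<^sub>v c)"
proof -
  have F': "F \<in> carrier_mat n k" using F G H A B by simp
  have "F\<^sup>T = G\<^sup>T * A\<^sup>T + H\<^sup>T * B\<^sup>T"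
    using G H A B by (simp add: F transpose_add[of _ n k] transpose_mult[of _ n _ _ k])
  then have "F\<^sup>T *\<^sub>v c = G\<^sup>T *\<^sub>v (A\<^sup>T *\<^sub>v c) + H\<^sup>T *\<^sub>v (B\<^sup>T *\<^sub>v c)"
    using G H A B c by (simp add: add_mult_distrib_mat_vec[of _ k n] assoc_mult_mat_vec[of _ k _ _ n])
  moreover have "G\<^sup>T *\<^sub>v (a - A\<^sup>T *\<^sub>v c) = G\<^sup>T *\<^sub>v a - G\<^sup>T *\<^sub>v (A\<^sup>T *\<^sub>v c)"
    using G A a c by (intro mult_minus_distrib_mat_vec[of _ k n']) auto
  moreover have "H\<^sup>T *\<^sub>v (b - B\<^sup>T *\<^sub>v c) = H\<^sup>T *\<^sub>v b - H\<^sup>T *\<^sub>v (B\<^sup>T *\<^sub>v c)"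
    using H B b c by (intro mult_minus_distrib_mat_vec[of _ k m]) auto
  ultimately show ?thesis
    unfolding transpose_stack3_mult_vec[OF F' G H c a b]
    using G H by (intro eq_vecI) (auto simp del: index_mult_mat_vec)
qed

text \<open>All conditions have the form F = A G + B H, with (F, G, H) equal to
  (\<open>X_plus X\<close>, \<open>X_minus X\<close>, \<open>U\<close>) for the data, and to
  (\<open>A\<^sub>m\<close>, I, \<open>K\<close>) and (\<open>B\<^sub>m\<close>, 0,
  \<open>L\<close>) for exactness, so the same stack lemmas treat all three.\<close>

lemma compatible_subset_exact_iff:
  fixes A\<^sub>m B\<^sub>m A\<^sub>s B\<^sub>s U X K L :: "real mat"
  assumes n: "n > 0"
    and Am: "A\<^sub>m \<in> carrier_mat n n" and Bm: "B\<^sub>m \<in> carrier_mat n p"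
    and As: "A\<^sub>s \<in> carrier_mat n n" and Bs: "B\<^sub>s \<in> carrier_mat n m"
    and X: "X \<in> carrier_mat n (T + 1)" and U: "U \<in> carrier_mat m T"
    and data: "X_plus X = A\<^sub>s * X_minus X + B\<^sub>s * U"
    and K: "K \<in> carrier_mat m n" and L: "L \<in> carrier_mat m p"
  shows "compatible_systems U X \<subseteq> exact_systems A\<^sub>m B\<^sub>m K L \<longleftrightarrow>
    (\<forall>z \<in> carrier_vec (n + (n + m)).
       (- X_plus X @\<^sub>r X_minus X @\<^sub>r U)\<^sup>T *\<^sub>v z = 0\<^sub>v T \<longrightarrow>
         (- A\<^sub>m @\<^sub>r 1\<^sub>m n @\<^sub>r K)\<^sup>T *\<^sub>v z = 0\<^sub>v n \<and> (- B\<^sub>m @\<^sub>r 0\<^sub>m n p @\<^sub>r L)\<^sup>T *\<^sub>v z = 0\<^sub>v p)"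
    (is "?L \<longleftrightarrow> ?R")
proof -
  have Xp: "X_plus X \<in> carrier_mat n T" and Xm: "X_minus X \<in> carrier_mat n T"
    using X by (auto simp: X_plus_def X_minus_def)
  have O: "0\<^sub>m n p \<in> carrier_mat n p" and I: "1\<^sub>m n \<in> carrier_mat n n" by auto
  have compat: "(A, B) \<in> compatible_systems U X \<longleftrightarrow>
      A \<in> carrier_mat n n \<and> B \<in> carrier_mat n m \<and> X_plus X = A * X_minus X + B * U" for A B
    using X U by (simp add: compatible_systems_def)
  have exact: "(A, B) \<in> exact_systems A\<^sub>m B\<^sub>m K L \<longleftrightarrow>
      A\<^sub>m = A * 1\<^sub>m n + B * K \<and> B\<^sub>m = A * 0\<^sub>m n p + B * L"
    if "A \<in> carrier_mat n n" "B \<in> carrier_mat n m" for A B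
    using that Am K L by (auto simp: exact_systems_def)
  show ?thesis
  proof
    assume sub: ?L
    \<comment> \<open>The true system is compatible, hence exact; now all three left-hand sides F
      are expressed through \<open>A\<^sub>s\<close> and \<open>B\<^sub>s\<close>.\<close>
    have s: "A\<^sub>m = A\<^sub>s * 1\<^sub>m n + B\<^sub>s * K" "B\<^sub>m = A\<^sub>s * 0\<^sub>m n p + B\<^sub>s * L"
      using sub compat exact[OF As Bs] As Bs data by blast+
    show ?R
    proof (intro ballI impI)
      fix z :: "real vec" assume "z \<in> carrier_vec (n + (n + m))"
      then obtain c a b where z: "z = c @\<^sub>v a @\<^sub>v b"
        and c: "c \<in> carrier_vec n" and a: "a \<in> carrier_vec n" and b: "b \<in> carrier_vec m"
        by (metis vec_first_last_append vec_first_carrier vec_last_carrier)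
      assume ker: "(- X_plus X @\<^sub>r X_minus X @\<^sub>r U)\<^sup>T *\<^sub>v z = 0\<^sub>v T"
      \<comment> \<open>What remains of z after eliminating \<open>c\<close> with the rows of [I
        \<open>A\<^sub>s\<close> \<open>B\<^sub>s\<close>]; these are the rows used to perturb the
        true system.\<close>
      define a' where "a' = a - A\<^sub>s\<^sup>T *\<^sub>v c"
      define b' where "b' = b - B\<^sub>s\<^sup>T *\<^sub>v c"
      have a': "a' \<in> carrier_vec n" and b': "b' \<in> carrier_vec m"
        unfolding a'_def b'_def using a b c As Bs
        by (auto intro!: minus_carrier_vec mult_mat_vec_carrier)
      let ?A = "repeat_row n a'" and ?B = "repeat_row n b'"
      have AB: "?A \<in> carrier_mat n n" "?B \<in> carrier_mat n m" using a' b' by auto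
      have pert: "?A * G + ?B * H = 0\<^sub>m n k \<longleftrightarrow> G\<^sup>T *\<^sub>v a' + H\<^sup>T *\<^sub>v b' = 0\<^sub>v k"
        if "G \<in> carrier_mat n k" "H \<in> carrier_mat m k" for G H k
        using that a' b' n repeat_row_eq_0_iff[of n "G\<^sup>T *\<^sub>v a' + H\<^sup>T *\<^sub>v b'" k]
        by (simp add: repeat_row_mult[of _ _ k] repeat_row_add)
      have expand: "(A\<^sub>s + ?A) * G + (B\<^sub>s + ?B) * H = (A\<^sub>s * G + B\<^sub>s * H) + (?A * G + ?B * H)"
        if "G \<in> carrier_mat n k" "H \<in> carrier_mat m k" for G H k
        using that As Bs AB
        by (simp add: add_mult_distrib_mat[of _ n _ _ _ k]) (intro eq_matI; auto)
      have cancel: "M = M + E \<longleftrightarrow> E = 0\<^sub>m n k"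
        if "M \<in> carrier_mat n k" "E \<in> carrier_mat n k" for M E :: "real mat" and k
        using that by (auto simp: mat_eq_iff)
      have red: "(- (A\<^sub>s * G + B\<^sub>s * H) @\<^sub>r G @\<^sub>r H)\<^sup>T *\<^sub>v z = G\<^sup>T *\<^sub>v a' + H\<^sup>T *\<^sub>v b'"
        if "G \<in> carrier_mat n k" "H \<in> carrier_mat m k" for G H k
        unfolding z a'_def b'_def by (rule stack3_reduce[OF that As Bs refl c a b])
      \<comment> \<open>For any G and H, the perturbed system reproduces the value of the true one
        exactly when z is in the kernel of the corresponding transposed stack.\<close>
      have pert_eq: "A\<^sub>s * G + B\<^sub>s * H = (A\<^sub>s + ?A) * G + (B\<^sub>s + ?B) * H \<longleftrightarrow>
          (- (A\<^sub>s * G + B\<^sub>s * H) @\<^sub>r G @\<^sub>r H)\<^sup>T *\<^sub>v z = 0\<^sub>v k"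
        if G: "G \<in> carrier_mat n k" and H: "H \<in> carrier_mat m k" for G H k
      proof -
        have "A\<^sub>s * G + B\<^sub>s * H \<in> carrier_mat n k" "?A * G + ?B * H \<in> carrier_mat n k"
          using G H As Bs AB by auto
        then show ?thesis
          unfolding expand[OF G H] red[OF G H] pert[OF G H, symmetric] by (rule cancel)
      qed
      \<comment> \<open>The equivalence is read from right to left for the data stack, giving
        compatibility and thus exactness, and then from left to right for the two model
        stacks.\<close>
      have "(A\<^sub>s + ?A, B\<^sub>s + ?B) \<in> compatible_systems U X"
        using ker pert_eq[OF Xm U] As Bs AB unfolding compat data by auto
      then have "A\<^sub>m = (A\<^sub>s + ?A) * 1\<^sub>m n + (B\<^sub>s + ?B) * K \<and> B\<^sub>m = (A\<^sub>s + ?A) * 0\<^sub>m n p + (B\<^sub>s + ?B) * L"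
        using sub exact[of "A\<^sub>s + ?A" "B\<^sub>s + ?B"] As Bs AB by auto
      then show "(- A\<^sub>m @\<^sub>r 1\<^sub>m n @\<^sub>r K)\<^sup>T *\<^sub>v z = 0\<^sub>v n \<and> (- B\<^sub>m @\<^sub>r 0\<^sub>m n p @\<^sub>r L)\<^sup>T *\<^sub>v z = 0\<^sub>v p"
        using pert_eq[OF I K] pert_eq[OF O L] unfolding s[symmetric] by blast
    qed
  next
    assume R: ?R
    show ?L
    proof (rule subrelI)
      fix A B assume "(A, B) \<in> compatible_systems U X"
      then have A: "A \<in> carrier_mat n n" and B: "B \<in> carrier_mat n m"
        and AB: "X_plus X = A * X_minus X + B * U" by (auto simp: compat)
      \<comment> \<open>Conversely, compatibility puts every row of [I A B] in the data kernel, so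
        the inclusions apply row by row.\<close>
      have "unit_vec n i @\<^sub>v row A i @\<^sub>v row B i \<in> carrier_vec (n + (n + m))" for i
        using A B by (auto intro!: carrier_vecI)
      then show "(A, B) \<in> exact_systems A\<^sub>m B\<^sub>m K L"
        using R AB unfolding exact[OF A B] stack3_kernel_rows[OF Xp Xm U A B]
          stack3_kernel_rows[OF Am I K A B] stack3_kernel_rows[OF Bm O L A B]
        by blast
    qed
  qed
qed

section \<open>Assembly of the equivalence\<close>

theorem corollary1:
  fixes n m p T :: nat
    and A\<^sub>m B\<^sub>m A\<^sub>s B\<^sub>s U X :: "real mat"
  assumes "n > 0" and "m > 0" and "p > 0" and "T > 0" and "m \<ge> p"
    and "A\<^sub>m \<in> carrier_mat n n" and "schur_stable A\<^sub>m"
    and "B\<^sub>m \<in> carrier_mat n p"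
    and "A\<^sub>s \<in> carrier_mat n n" and "B\<^sub>s \<in> carrier_mat n m"
    and "X \<in> carrier_mat n (T + 1)" and "U \<in> carrier_mat m T"
    and "X_plus X = A\<^sub>s * X_minus X + B\<^sub>s * U"
  shows "informative_MRC A\<^sub>m B\<^sub>m U X \<longleftrightarrow>
    (\<exists>K \<in> carrier_mat m n. \<exists>L \<in> carrier_mat m p. \<exists>\<alpha>\<^sub>1 > 0. \<exists>\<alpha>\<^sub>2 > 0.
       pos_semidef
          ((X_plus X * (X_plus X)\<^sup>T @\<^sub>c - (X_plus X * (X_minus X)\<^sup>T) @\<^sub>c - (X_plus X * U\<^sup>T) @\<^sub>c - A\<^sub>m) @\<^sub>r
           (- (X_minus X * (X_plus X)\<^sup>T) @\<^sub>c X_minus X * (X_minus X)\<^sup>T @\<^sub>c X_minus X * U\<^sup>T @\<^sub>c 1\<^sub>m n) @\<^sub>r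
           (- (U * (X_plus X)\<^sup>T) @\<^sub>c U * (X_minus X)\<^sup>T @\<^sub>c U * U\<^sup>T @\<^sub>c K) @\<^sub>r
           (- A\<^sub>m\<^sup>T @\<^sub>c 1\<^sub>m n @\<^sub>c K\<^sup>T @\<^sub>c \<alpha>\<^sub>1 \<cdot>\<^sub>m 1\<^sub>m n)) \<and>
       pos_semidef
          ((X_plus X * (X_plus X)\<^sup>T @\<^sub>c - (X_plus X * (X_minus X)\<^sup>T) @\<^sub>c - (X_plus X * U\<^sup>T) @\<^sub>c - B\<^sub>m) @\<^sub>r
           (- (X_minus X * (X_plus X)\<^sup>T) @\<^sub>c X_minus X * (X_minus X)\<^sup>T @\<^sub>c X_minus X * U\<^sup>T @\<^sub>c 0\<^sub>m n p) @\<^sub>r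
           (- (U * (X_plus X)\<^sup>T) @\<^sub>c U * (X_minus X)\<^sup>T @\<^sub>c U * U\<^sup>T @\<^sub>c L) @\<^sub>r
           (- B\<^sub>m\<^sup>T @\<^sub>c 0\<^sub>m p n @\<^sub>c L\<^sup>T @\<^sub>c \<alpha>\<^sub>2 \<cdot>\<^sub>m 1\<^sub>m p)))"
    (is "_ \<longleftrightarrow> (\<exists>K \<in> _. \<exists>L \<in> _. \<exists>\<alpha>\<^sub>1 > 0. \<exists>\<alpha>\<^sub>2 > 0.
      pos_semidef (?M\<^sub>1 K \<alpha>\<^sub>1) \<and> pos_semidef (?M\<^sub>2 L \<alpha>\<^sub>2))")
proof -
  note Am = assms(6) and Bm = assms(8) and X = assms(11) and U = assms(12)
  have Xp: "X_plus X \<in> carrier_mat n T" and Xm: "X_minus X \<in> carrier_mat n T"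
    using X by (auto simp: X_plus_def X_minus_def)
  have O: "0\<^sub>m n p \<in> carrier_mat n p" and I: "1\<^sub>m n \<in> carrier_mat n n" by auto
  have W: "- X_plus X @\<^sub>r X_minus X @\<^sub>r U \<in> carrier_mat (n + (n + m)) T"
    using Xp Xm U by auto
  have "informative_MRC A\<^sub>m B\<^sub>m U X \<longleftrightarrow> (\<exists>K \<in> carrier_mat m n. \<exists>L \<in> carrier_mat m p.
      compatible_systems U X \<subseteq> exact_systems A\<^sub>m B\<^sub>m K L)"
    using X U Bm by (simp add: informative_MRC_def)
  \<comment> \<open>For fixed gains the two scalars occur in separate inequalities, so their
    existence splits into two independent claims, one per kernel inclusion.\<close>
  moreover have "compatible_systems U X \<subseteq> exact_systems A\<^sub>m B\<^sub>m K L \<longleftrightarrow>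
      (\<exists>\<alpha>\<^sub>1 > 0. pos_semidef (?M\<^sub>1 K \<alpha>\<^sub>1)) \<and> (\<exists>\<alpha>\<^sub>2 > 0. pos_semidef (?M\<^sub>2 L \<alpha>\<^sub>2))"
    if K: "K \<in> carrier_mat m n" and L: "L \<in> carrier_mat m p" for K L
  proof -
    have N: "- A\<^sub>m @\<^sub>r 1\<^sub>m n @\<^sub>r K \<in> carrier_mat (n + (n + m)) n"
      "- B\<^sub>m @\<^sub>r 0\<^sub>m n p @\<^sub>r L \<in> carrier_mat (n + (n + m)) p"
      using Am Bm K L by auto
    have D: "\<alpha> \<cdot>\<^sub>m 1\<^sub>m k \<in> carrier_mat k k" for \<alpha> :: real and k by simp
    \<comment> \<open>The transposed middle blocks I^T and 0^T simplify to the I and 0 of the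
      displayed last block rows.\<close>
    have M: "?M\<^sub>1 K \<alpha> = four_block_mat
        ((- X_plus X @\<^sub>r X_minus X @\<^sub>r U) * (- X_plus X @\<^sub>r X_minus X @\<^sub>r U)\<^sup>T)
        (- A\<^sub>m @\<^sub>r 1\<^sub>m n @\<^sub>r K) (- A\<^sub>m @\<^sub>r 1\<^sub>m n @\<^sub>r K)\<^sup>T (\<alpha> \<cdot>\<^sub>m 1\<^sub>m n)"
      "?M\<^sub>2 L \<alpha> = four_block_mat
        ((- X_plus X @\<^sub>r X_minus X @\<^sub>r U) * (- X_plus X @\<^sub>r X_minus X @\<^sub>r U)\<^sup>T)
        (- B\<^sub>m @\<^sub>r 0\<^sub>m n p @\<^sub>r L) (- B\<^sub>m @\<^sub>r 0\<^sub>m n p @\<^sub>r L)\<^sup>T (\<alpha> \<cdot>\<^sub>m 1\<^sub>m p)" for \<alpha>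
      using block_matrix_eq[OF Xp Xm U Am I K D] block_matrix_eq[OF Xp Xm U Bm O L D] by simp_all
    show ?thesis
      unfolding compatible_subset_exact_iff[OF assms(1) Am Bm assms(9,10) X U assms(13) K L]
        M pos_semidef_four_block_iff[OF W N(1)] pos_semidef_four_block_iff[OF W N(2)]
      by blast
  qed
  ultimately show ?thesis by blast
qed

end
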